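(* Let $N\ge 1$ be an integer and let $\sigma_n\subset\mathbb{R}^N$ be an $n$-simplex, $n\ge 0$. Then there is one and only one geometrically independent set of points of $\mathbb{R}^N$ spanning $\sigma_n$.
   Context: Points $\mathbf{a}_0,\ldots,\mathbf{a}_n$ of $\mathbb{R}^N$ are geometrically independent if for all real scalars $t_i$, the equations $\sum_{i=0}^n t_i=0$ and $\sum_{i=0}^n t_i\mathbf{a}_i=\mathbf{0}$ imply $t_i=0$ for all $i$. A geometrically independent set $\{\mathbf{a}_0,\ldots,\mathbf{a}_n\}$ spans the $n$-simplex $\{\sum_{i=0}^n t_i\mathbf{a}_i : t_i\ge 0,\ \sum_{i=0}^n t_i=1\}$; an $n$-simplex is a subset of $\mathbb{R}^N$ of this form. Spanning sets are unordered finite sets. *)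

theory Defs
  imports "HOL-Analysis.Analysis"
begin

text \<open>
  The family \<open>a\<^sub>0, \<dots>, a\<^sub>n\<close> is rendered as the finite set of its members, with the scalars
  \<open>t\<^sub>i\<close> indexed by the points themselves. Nothing is lost: an independent family has no repetitions
  (take \<open>t\<^sub>i = 1\<close>, \<open>t\<^sub>j = -1\<close> if \<open>a\<^sub>i = a\<^sub>j\<close>).
\<close>

definition geom_independent :: "'a::real_vector set \<Rightarrow> bool" where
  "geom_independent A \<longleftrightarrow> finite A \<and>
     (\<forall>t :: 'a \<Rightarrow> real. (\<Sum>a\<in>A. t a) = 0 \<and> (\<Sum>a\<in>A. t a *\<^sub>R a) = 0 \<longrightarrow> (\<forall>a\<in>A. t a = 0))"

definition spanned_simplex :: "'a::real_vector set \<Rightarrow> 'a set" where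
  "spanned_simplex A =
     {(\<Sum>a\<in>A. t a *\<^sub>R a) | t :: 'a \<Rightarrow> real. (\<forall>a\<in>A. 0 \<le> t a) \<and> (\<Sum>a\<in>A. t a) = 1}"

definition n_simplex :: "nat \<Rightarrow> 'a::real_vector set \<Rightarrow> bool" where
  "n_simplex n S \<longleftrightarrow> (\<exists>A. geom_independent A \<and> card A = n + 1 \<and> S = spanned_simplex A)"

text \<open>Agreement with the library's affine independence, convex hulls and simplices.\<close>

lemma geom_independent_iff_not_affine_dependent:
  "geom_independent A \<longleftrightarrow> finite A \<and> \<not> affine_dependent A"
  unfolding geom_independent_def using affine_dependent_explicit_finite[of A] by blast

lemma spanned_simplex_eq_convex_hull:
  "finite A \<Longrightarrow> spanned_simplex A = convex hull A"
  unfolding spanned_simplex_def by (auto simp: convex_hull_finite)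

lemma n_simplex_iff_simplex:
  fixes S :: "'a::euclidean_space set"
  shows "n_simplex n S \<longleftrightarrow> int n simplex S"
proof -
  have "geom_independent A \<longleftrightarrow> \<not> affine_dependent A" for A :: "'a set"
    using aff_independent_finite geom_independent_iff_not_affine_dependent by blast
  then show ?thesis
    unfolding n_simplex_def simplex_def
    by (metis (no_types, lifting) aff_independent_finite of_nat_1 of_nat_add of_nat_eq_iff
        spanned_simplex_eq_convex_hull)
qed

end

theory Submission
  imports Defs
begin

text \<open>A simplex, as a bare point set, determines its vertices: they are its extreme points.
  Barycentric coordinates are unique by independence, so a vertex is interior to no segment of the
  simplex, while a point with two positive weights is.\<close>

lemma geom_independent_eq_extreme_points:
  fixes A :: "'a::euclidean_space set"
  assumes "geom_independent A"
  shows "A = {x. x extreme_point_of spanned_simplex A}"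
  using assms extreme_point_of_convex_hull_affine_independent[of A]
  by (simp add: geom_independent_iff_not_affine_dependent spanned_simplex_eq_convex_hull)

theorem theorem3p17:
  fixes \<sigma> :: "(real ^ 'N) set" and n :: nat
  assumes "n_simplex n \<sigma>"
  shows "\<exists>!A. geom_independent A \<and> spanned_simplex A = \<sigma>"
proof (rule ex_ex1I)
  show "\<exists>A. geom_independent A \<and> spanned_simplex A = \<sigma>"
    using assms unfolding n_simplex_def by blast
next
  fix A B
  assume "geom_independent A \<and> spanned_simplex A = \<sigma>"
    and "geom_independent B \<and> spanned_simplex B = \<sigma>"
  \<comment> \<open>Both are the set of extreme points of \<open>\<sigma>\<close>, which refers to
    no spanning set.\<close>
  then show "A = B"
    using geom_independent_eq_extreme_points by metis
qed

end
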